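(* Let $G$ be a finitely generated group and $X$ any finite symmetric generating set. Let $Z$ be a (possibly infinite) generating set of $G$ and let $H$ be a finitely generated subgroup of $G$ which is quasi-isometrically embedded in $(G,d_Z)$. Suppose the action of $G$ on the Cayley graph $\Gamma(G,Z)$ is acylindrical and $\Gamma(G,Z)$ is hyperbolic. Then $(G,X)$ has BCD relative to $H$, i.e. there is $K\ge 0$ such that for every word $U$ over $X$ that has minimal length among all words representing elements of the $G$-conjugacy class of the element it represents, and that represents an element conjugate into $H$, there exist $g\in G$ with $|g|_X\le K$ and a cyclic permutation $U'$ of $U$ such that $gU'g^{-1}\in H$.
   Context: Generating sets generate $G$ as a monoid and are closed under inverses; $G$ acts on $\Gamma(G,Z)$ by left multiplication. An isometric action on a metric space $(S,d)$ is acylindrical if for every $\epsilon>0$ there exist $R,N\ge0$ such that for all $x,y\in S$ with $d(x,y)\ge R$ at most $N$ elements $g$ satisfy $d(x,gx)\le\epsilon$ and $d(y,gy)\le\epsilon$. A cyclic permutation of a word is a cyclic shift of its letters. *)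

theory Defs
  imports "HOL-Algebra.Algebra"
begin

definition word_eval :: "('a, 'b) monoid_scheme \<Rightarrow> 'a list \<Rightarrow> 'a" where
  "word_eval G w = foldr (\<lambda>x y. x \<otimes>\<^bsub>G\<^esub> y) w \<one>\<^bsub>G\<^esub>"

definition gen_set_of :: "('a, 'b) monoid_scheme \<Rightarrow> 'a set \<Rightarrow> 'a set \<Rightarrow> bool" where
  "gen_set_of G H S \<longleftrightarrow> S \<subseteq> H \<and> (\<forall>s\<in>S. inv\<^bsub>G\<^esub> s \<in> S)
     \<and> (\<forall>h\<in>H. \<exists>w\<in>lists S. word_eval G w = h)"

abbreviation gen_set :: "('a, 'b) monoid_scheme \<Rightarrow> 'a set \<Rightarrow> bool" where
  "gen_set G S \<equiv> gen_set_of G (carrier G) S"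

definition word_len :: "('a, 'b) monoid_scheme \<Rightarrow> 'a set \<Rightarrow> 'a \<Rightarrow> nat" where
  "word_len G S g = (LEAST n. \<exists>w\<in>lists S. length w = n \<and> word_eval G w = g)"

definition word_dist :: "('a, 'b) monoid_scheme \<Rightarrow> 'a set \<Rightarrow> 'a \<Rightarrow> 'a \<Rightarrow> real" where
  "word_dist G S g h = real (word_len G S (inv\<^bsub>G\<^esub> g \<otimes>\<^bsub>G\<^esub> h))"

text \<open>Gromov hyperbolicity (four-point condition with Gromov products) of the
  vertex set of the Cayley graph, with its (path / word) metric.\<close>
definition gromov_prod :: "('a, 'b) monoid_scheme \<Rightarrow> 'a set \<Rightarrow> 'a \<Rightarrow> 'a \<Rightarrow> 'a \<Rightarrow> real" where
  "gromov_prod G S x y w =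
     (word_dist G S x w + word_dist G S y w - word_dist G S x y) / 2"

definition cayley_hyperbolic :: "('a, 'b) monoid_scheme \<Rightarrow> 'a set \<Rightarrow> bool" where
  "cayley_hyperbolic G S \<longleftrightarrow> (\<exists>\<delta>::real. \<delta> \<ge> 0 \<and>
     (\<forall>x\<in>carrier G. \<forall>y\<in>carrier G. \<forall>z\<in>carrier G. \<forall>w\<in>carrier G.
        gromov_prod G S x y w \<ge> min (gromov_prod G S x z w) (gromov_prod G S y z w) - \<delta>))"

definition acylindrical_action :: "('a, 'b) monoid_scheme \<Rightarrow> 'a set \<Rightarrow> bool" where
  "acylindrical_action G S \<longleftrightarrow> (\<forall>\<epsilon>::real. \<epsilon> > 0 \<longrightarrow>
     (\<exists>R::real. \<exists>N::nat. R \<ge> 0 \<and> (\<forall>x\<in>carrier G. \<forall>y\<in>carrier G.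
        word_dist G S x y \<ge> R \<longrightarrow>
        (let A = {g\<in>carrier G. word_dist G S x (g \<otimes>\<^bsub>G\<^esub> x) \<le> \<epsilon> \<and>
                                word_dist G S y (g \<otimes>\<^bsub>G\<^esub> y) \<le> \<epsilon>}
         in finite A \<and> card A \<le> N))))"

definition fin_gen_subgroup :: "('a, 'b) monoid_scheme \<Rightarrow> 'a set \<Rightarrow> bool" where
  "fin_gen_subgroup G H \<longleftrightarrow> subgroup H G \<and> (\<exists>S. finite S \<and> gen_set_of G H S)"

definition qi_embedded :: "('a, 'b) monoid_scheme \<Rightarrow> 'a set \<Rightarrow> 'a set \<Rightarrow> bool" where
  "qi_embedded G H Z \<longleftrightarrow> (\<exists>S. finite S \<and> gen_set_of G H S \<and>
     (\<exists>L::real. \<exists>c::real. L \<ge> 1 \<and> c \<ge> 0 \<and> (\<forall>h1\<in>H. \<forall>h2\<in>H.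
        word_dist G S h1 h2 / L - c \<le> word_dist G Z h1 h2 \<and>
        word_dist G Z h1 h2 \<le> L * word_dist G S h1 h2 + c)))"

definition BCD_rel :: "('a, 'b) monoid_scheme \<Rightarrow> 'a set \<Rightarrow> 'a set \<Rightarrow> bool" where
  "BCD_rel G Xs H \<longleftrightarrow> (\<exists>K::nat. \<forall>U\<in>lists Xs.
     (\<forall>V\<in>lists Xs. (\<exists>g\<in>carrier G. word_eval G V = g \<otimes>\<^bsub>G\<^esub> word_eval G U \<otimes>\<^bsub>G\<^esub> m_inv G g)
         \<longrightarrow> length U \<le> length V)
     \<longrightarrow> (\<exists>g\<in>carrier G. g \<otimes>\<^bsub>G\<^esub> word_eval G U \<otimes>\<^bsub>G\<^esub> m_inv G g \<in> H)
     \<longrightarrow> (\<exists>g\<in>carrier G. word_len G Xs g \<le> K \<and>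
           (\<exists>k. g \<otimes>\<^bsub>G\<^esub> word_eval G (rotate k U) \<otimes>\<^bsub>G\<^esub> m_inv G g \<in> H)))"

end

theory Submission
  imports Defs "HOL-Real_Asymp.Real_Asymp"
begin

text \<open>
  Write \<open>h = a\<inverse> u a \<in> H\<close> for the element \<open>u\<close> represented by \<open>U\<close>, and let \<open>\<gamma>\<close> be the path from
  \<open>a\<inverse>\<close> to \<open>a\<inverse> u = h a\<inverse>\<close> labelled by \<open>U\<close>. It suffices to find a point of \<open>\<gamma>\<close> at bounded
  \<open>X\<close>-distance from \<open>H\<close>. Let \<open>\<pi>\<close> be a nearest point projection to \<open>H\<close> with respect to \<open>d\<^sub>Z\<close>.

  Chains in \<open>H\<close> between \<open>\<pi> p\<close> and \<open>\<pi> q\<close> have length linear in \<open>d\<^sub>Z (\<pi> p) (\<pi> q)\<close> and avoid a ball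
  around \<open>p\<close>; the four-point inequality along a chain loses only the logarithm of its length.
  This makes \<open>\<pi>\<close> contracting, without any stability theorem for quasi-geodesics.

  The endpoints of \<open>\<gamma>\<close> project to \<open>x\<close> and \<open>h x\<close> for some \<open>x \<in> H\<close>. Since \<open>U\<close> is shortest in its
  conjugacy class, \<open>length U\<close> is at most a multiple of the length of \<open>x\<inverse> h x\<close>, so the projection
  advances at a definite average rate along \<open>\<gamma>\<close>. Parts of \<open>\<gamma>\<close> far from \<open>H\<close> advance more slowly than
  that, so a long \<open>\<gamma>\<close> has two points within bounded \<open>X\<close>-distance of each other that are \<open>d\<^sub>Z\<close>-close
  to \<open>H\<close> and whose projections are far apart. Acylindricity leaves only finitely many
  possibilities for the element leading from such a point to its projection. Short words \<open>U\<close>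
  are finite in number.
\<close>

section \<open>Projections in four-point hyperbolic spaces\<close>

text \<open>Since a logarithm is sublinear, an estimate
  \<open>D \<le> b + c * log 2 (A * (D + 1))\<close> forces \<open>D \<le> B\<close> with
  \<open>B\<close> depending only on \<open>A\<close>, \<open>b\<close> and \<open>c\<close>. It
  turns logarithmic losses into uniform constants.\<close>

lemma sublinear_log_bound:
  fixes A b c :: real
  assumes "A > 0"
  shows "\<exists>B\<ge>0. \<forall>D>B. b + c * log 2 (A * (D + 1)) < D"
proof -
  have "((\<lambda>D. (b + c * log 2 (A * (D + 1))) / D) \<longlongrightarrow> 0) at_top"
  proof -
    have 1: "((\<lambda>D::real. log 2 (A * (D + 1)) / D) \<longlongrightarrow> 0) at_top"
      using assms by real_asymp
    have 2: "((\<lambda>D::real. b / D) \<longlongrightarrow> 0) at_top"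
      by real_asymp
    have "((\<lambda>D::real. b / D + c * (log 2 (A * (D + 1)) / D)) \<longlongrightarrow> 0 + c * 0) at_top"
      by (intro tendsto_intros 1 2)
    then show ?thesis by (simp add: add_divide_distrib)
  qed
  then have "\<forall>\<^sub>F D in at_top. (b + c * log 2 (A * (D + 1))) / D < 1"
    by (rule order_tendstoD) simp
  then obtain B where B: "\<And>D. D \<ge> B \<Longrightarrow> (b + c * log 2 (A * (D + 1))) / D < 1"
    by (auto simp: eventually_at_top_linorder)
  show ?thesis
  proof (intro exI[of _ "max B 0"] conjI allI impI)
    fix D assume "D > max B 0"
    then show "b + c * log 2 (A * (D + 1)) < D"
      using B[of D] by (simp add: divide_less_eq)
  qed simp
qed

text \<open>Cutting the range into blocks of \<open>m\<close> steps leaves at most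
  \<open>(t - s) / m + 1\<close> blocks, each of displacement at most \<open>P\<close>. The quotient
  is real division.\<close>

lemma bounded_steps_imp_linear:
  fixes d :: "'a \<Rightarrow> 'a \<Rightarrow> real" and f :: "nat \<Rightarrow> 'a" and m :: nat
  assumes "m > 0" and "P \<ge> 0" and "s \<le> t"
    and "\<And>i j k. d (f i) (f k) \<le> d (f i) (f j) + d (f j) (f k)"
    and "\<And>i j. s \<le> i \<Longrightarrow> i \<le> j \<Longrightarrow> j \<le> t \<Longrightarrow> j - i \<le> m \<Longrightarrow> d (f i) (f j) \<le> P"
  shows "d (f s) (f t) \<le> P * (real (t - s) / m + 1)"
  using assms(3,5)
proof (induction "t - s" arbitrary: s rule: less_induct)
  case less
  show ?case
  proof (cases "t - s \<le> m")
    case True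
    then have "d (f s) (f t) \<le> P * 1" using less.prems by simp
    also have "\<dots> \<le> P * (real (t - s) / m + 1)"
      using assms(2) by (intro mult_left_mono) auto
    finally show ?thesis .
  next
    case False
    have "d (f (s + m)) (f t) \<le> P * (real (t - (s + m)) / m + 1)"
      using False assms(1) less.prems by (intro less.hyps) auto
    moreover have "d (f s) (f (s + m)) \<le> P" using False by (intro less.prems) auto
    moreover have "real (t - s) = real (t - (s + m)) + m" using False by auto
    then have "P * (real (t - s) / m + 1) = P + P * (real (t - (s + m)) / m + 1)"
      using assms(1) by (simp add: field_simps)
    ultimately show ?thesis using assms(4)[of s t "s + m"] by linarith
  qed
qed

section \<open>Four-point hyperbolicity and chains\<close>

text \<open>\<open>four_point\<close> is the Gromov product inequality with base point
  \<open>w\<close>, multiplied by 2 and rearranged into sums of distances; this accounts for the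
  factor in \<open>2 * \<delta>\<close>.\<close>

locale hyperbolic_metric =
  fixes M :: "'a set" and d :: "'a \<Rightarrow> 'a \<Rightarrow> real" and \<delta> :: real
  assumes nonneg: "d x y \<ge> 0"
    and refl: "x \<in> M \<Longrightarrow> d x x = 0"
    and sym: "\<lbrakk>x \<in> M; y \<in> M\<rbrakk> \<Longrightarrow> d x y = d y x"
    and triangle: "\<lbrakk>x \<in> M; y \<in> M; z \<in> M\<rbrakk> \<Longrightarrow> d x z \<le> d x y + d y z"
    and delta_nonneg: "\<delta> \<ge> 0"
    and four_point: "\<lbrakk>x \<in> M; y \<in> M; z \<in> M; w \<in> M\<rbrakk> \<Longrightarrow>
      d x y + d z w \<le> max (d x z + d y w) (d y z + d x w) + 2 * \<delta>"
begin

text \<open>Twice the Gromov product of the endpoints at \<open>p\<close>: each halving of the chain costs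
  only \<open>\<delta>\<close>, so a chain avoiding a ball around \<open>p\<close> loses only logarithmically in its length.\<close>
lemma gromov_product_chain:
  fixes i j k :: nat
  assumes "i \<le> j" "j - i \<le> 2 ^ k" and "p \<in> M" "s \<ge> 0"
    and "\<And>l. i \<le> l \<Longrightarrow> l \<le> j \<Longrightarrow> f l \<in> M \<and> d p (f l) \<ge> \<rho>"
    and "\<And>l. i \<le> l \<Longrightarrow> l < j \<Longrightarrow> d (f l) (f (Suc l)) \<le> s"
  shows "2 * \<rho> - s - 2 * real k * \<delta> \<le> d p (f i) + d p (f j) - d (f i) (f j)"
  using assms(1,2,5,6)
proof (induction k arbitrary: i j)
  case 0
  then consider "j = i" | "j = Suc i" by force
  then show ?case
  proof cases
    case 1
    then show ?thesis using 0(3)[of i] refl[of "f i"] assms(4) by auto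
  next
    case 2
    then show ?thesis using 0(3)[of i] 0(3)[of j] 0(4)[of i] by auto
  qed
next
  case (Suc k)
  define l where "l = (i + j) div 2"
  have l: "i \<le> l" "l \<le> j" "l - i \<le> 2 ^ k" "j - l \<le> 2 ^ k"
    using Suc.prems(1,2) by (auto simp: l_def)
  have 1: "2 * \<rho> - s - 2 * real k * \<delta> \<le> d p (f i) + d p (f l) - d (f i) (f l)"
    using l Suc.prems by (intro Suc.IH) auto
  have 2: "2 * \<rho> - s - 2 * real k * \<delta> \<le> d p (f l) + d p (f j) - d (f l) (f j)"
    using l Suc.prems by (intro Suc.IH) auto
  have M: "f i \<in> M" "f j \<in> M" "f l \<in> M" using Suc.prems(3) Suc.prems(1) l by auto
  show ?case
    using 1 2 four_point[of "f i" "f j" "f l" p] M assms(3)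
      sym[of "f i" p] sym[of "f j" p] sym[of "f l" p] sym[of "f j" "f l"]
    by (auto simp: algebra_simps max_def split: if_splits)
qed

section \<open>Contraction of nearest point projections\<close>

text \<open>A relation rather than a map: nearest points need not be unique, and a later choice of
  them has to respect a translation.\<close>

definition nearest :: "'a set \<Rightarrow> 'a \<Rightarrow> 'a \<Rightarrow> bool" where
  "nearest Y p x \<longleftrightarrow> x \<in> Y \<and> (\<forall>y\<in>Y. d p x \<le> d p y)"

text \<open>A coarse substitute for joining points of \<open>Y\<close> by quasi-geodesics inside
  \<open>Y\<close>: only the number of steps between the two ends is controlled, not that of
  subchains.\<close>

definition linearly_connected :: "'a set \<Rightarrow> real \<Rightarrow> real \<Rightarrow> bool" where
  "linearly_connected Y s A \<longleftrightarrow> (\<forall>x\<in>Y. \<forall>y\<in>Y. \<exists>f N. f 0 = x \<and> f N = y \<and> f ` {..N} \<subseteq> Y \<and>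
     (\<forall>l<N. d (f l) (f (Suc l)) \<le> s) \<and> real N \<le> A * (d x y + 1))"

text \<open>No point of \<open>Y\<close> is closer to \<open>p\<close> than \<open>x\<close>, so a
  chain in \<open>Y\<close> from \<open>x\<close> to \<open>y\<close> keeps distance at least
  \<open>d p x\<close> from \<open>p\<close>. \<open>gromov_product_chain\<close> applies with this
  radius and with \<open>k\<close> the rounded-up binary logarithm of the bound on the chain length.
  Up to a logarithm, the way from \<open>p\<close> to \<open>y\<close> passes through
  \<open>x\<close>.\<close>

lemma nearest_point_log_bound:
  assumes "linearly_connected Y s A" "Y \<subseteq> M" "s \<ge> 0" "A \<ge> 1"
    and "p \<in> M" "nearest Y p x" "y \<in> Y"
  shows "d p x + d x y - s - 2 * \<delta> * (log 2 (A * (d x y + 1)) + 1) \<le> d p y"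
proof -
  obtain f N where f: "f 0 = x" "f N = y" "f ` {..N} \<subseteq> Y"
    "\<And>l. l < N \<Longrightarrow> d (f l) (f (Suc l)) \<le> s" "real N \<le> A * (d x y + 1)"
    using assms unfolding linearly_connected_def nearest_def by metis
  define t where "t = A * (d x y + 1)"
  have t: "t \<ge> 1" using mult_mono[of 1 A 1 "d x y + 1"] assms(4) nonneg[of x y] by (simp add: t_def)
  define k where "k = nat \<lceil>log 2 t\<rceil>"
  have log0: "log 2 t \<ge> 0" using t by simp
  have kt: "real k \<ge> log 2 t" unfolding k_def by linarith
  have k1: "real k \<le> log 2 t + 1" unfolding k_def using log0 by linarith
  have "t = 2 powr log 2 t" using t by simp
  also have "\<dots> \<le> 2 powr real k" using kt by simp
  finally have "t \<le> 2 ^ k" by (simp add: powr_realpow)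
  then have "real N \<le> 2 ^ k" using f(5) unfolding t_def by linarith
  then have N: "N - 0 \<le> 2 ^ k" by simp
  have "2 * d p x - s - 2 * real k * \<delta> \<le> d p (f 0) + d p (f N) - d (f 0) (f N)"
    using N f assms by (intro gromov_product_chain) (auto simp: nearest_def)
  moreover have "real k * \<delta> \<le> (log 2 t + 1) * \<delta>"
    using k1 delta_nonneg by (intro mult_right_mono) auto
  ultimately show ?thesis using f(1,2) by (simp add: t_def algebra_simps)
qed

text \<open>Let \<open>D = d x y\<close>. The logarithmic bounds for \<open>p\<close> and for
  \<open>q\<close> make \<open>d p y + d q x\<close> exceed \<open>d p x + d q y\<close> by about
  \<open>2 * D\<close>. By the four-point condition the excess is at most
  \<open>max (D + T) 0 + 2 * \<delta>\<close>. Either way \<open>D\<close> is bounded by a logarithm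
  of itself, hence uniformly.\<close>

lemma contracting_projection:
  assumes "linearly_connected Y s A" "Y \<subseteq> M" "s \<ge> 0" "A \<ge> 1"
  shows "\<exists>B\<ge>0. \<forall>p\<in>M. \<forall>q\<in>M. \<forall>x y. nearest Y p x \<longrightarrow> nearest Y q y \<longrightarrow>
    d p q \<le> d p x + d q y + T \<longrightarrow> d x y \<le> B"
proof -
  obtain B where B: "B \<ge> 0"
    "\<And>D. D > B \<Longrightarrow> (2 * s + 6 * \<delta> + max T 0) + 4 * \<delta> * log 2 (A * (D + 1)) < D"
    using sublinear_log_bound[of A "2 * s + 6 * \<delta> + max T 0" "4 * \<delta>"] assms(4) by auto
  have "d x y \<le> B" if H: "p \<in> M" "q \<in> M" "nearest Y p x" "nearest Y q y"
    "d p q \<le> d p x + d q y + T" for p q x y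
  proof (rule ccontr)
    assume "\<not> d x y \<le> B"
    then have 0: "(2 * s + 6 * \<delta> + max T 0) + 4 * \<delta> * log 2 (A * (d x y + 1)) < d x y"
      using B(2) by simp
    have Y: "x \<in> Y" "y \<in> Y" "x \<in> M" "y \<in> M" using H assms(2) by (auto simp: nearest_def)
    have 1: "d p x + d x y - s - 2 * \<delta> * (log 2 (A * (d x y + 1)) + 1) \<le> d p y"
      using assms H Y by (intro nearest_point_log_bound) auto
    have 2: "d q y + d x y - s - 2 * \<delta> * (log 2 (A * (d x y + 1)) + 1) \<le> d q x"
      using nearest_point_log_bound[OF assms H(2,4) Y(1)] sym[OF Y(3,4)] by simp
    have 3: "d p y + d q x \<le> max (d p q + d x y) (d p x + d q y) + 2 * \<delta>"
      using four_point[of p y q x] H Y sym[of y q] sym[of y x] by (auto simp: max_def algebra_simps)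
    show False
      using 0 1 2 3 H(5) nonneg[of x y] by (auto simp: max_def algebra_simps split: if_splits)
  qed
  then show ?thesis using B(1) by blast
qed

section \<open>Progress of the projection along a path\<close>

text \<open>Take the first and the last index whose point lies within \<open>L * m\<close> of its
  projection. Outside them, \<open>m\<close> steps along the path are too short to reach the target,
  so contraction limits the projection to \<open>B\<close> per \<open>m\<close> steps. The
  displacement beyond this must occur between the two indices. In the constant 4, each of the two
  outer stretches counts 1 for an incomplete block and 1 for the single step joining it to the near
  point.\<close>

lemma near_points_in_piece:
  fixes m :: nat
  assumes "Y \<subseteq> M" and "B \<ge> 0" "m > 0" "s \<le> t"
    and contr: "\<And>p q x y. \<lbrakk>p \<in> M; q \<in> M; nearest Y p x; nearest Y q y;
      d p q \<le> d p x + d q y + L\<rbrakk> \<Longrightarrow> d x y \<le> B"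
    and path: "\<And>i. s \<le> i \<Longrightarrow> i \<le> t \<Longrightarrow> \<gamma> i \<in> M \<and> nearest Y (\<gamma> i) (\<pi> i)"
    and lip: "\<And>i j. s \<le> i \<Longrightarrow> i \<le> j \<Longrightarrow> j \<le> t \<Longrightarrow> d (\<gamma> i) (\<gamma> j) \<le> L * real (j - i)"
    and L: "L \<ge> 0"
    and big: "d (\<pi> s) (\<pi> t) > B * (real (t - s) / m + 4) + Q"
    and Q: "Q \<ge> 0"
  shows "\<exists>i j. s \<le> i \<and> i \<le> j \<and> j \<le> t \<and> d (\<gamma> i) (\<pi> i) \<le> L * m \<and> d (\<gamma> j) (\<pi> j) \<le> L * m
    \<and> d (\<pi> i) (\<pi> j) \<ge> Q"
proof -
  have piM: "\<pi> i \<in> M" if "s \<le> i" "i \<le> t" for i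
    using path[OF that] assms(1) by (auto simp: nearest_def)
  have far: "d (\<pi> a) (\<pi> b) \<le> B * (real (b - a) / m + 1)"
    if ab: "s \<le> a" "a \<le> b" "b \<le> t" and f: "\<And>i. a \<le> i \<Longrightarrow> i \<le> b \<Longrightarrow> d (\<gamma> i) (\<pi> i) > L * m" for a b
  proof -
    \<comment> \<open>Clamping the index keeps all values in \<open>M\<close>, since
      \<open>bounded_steps_imp_linear\<close> asks for the triangle inequality at all
      indices.\<close>
    define g where "g i = \<pi> (min b (max a i))" for i
    have "d (g a) (g b) \<le> B * (real (b - a) / m + 1)"
    proof (rule bounded_steps_imp_linear[where f = g])
      show "d (g i) (g k) \<le> d (g i) (g j) + d (g j) (g k)" for i j k
        unfolding g_def using ab by (intro triangle piM) auto
      fix i j assume ij: "a \<le> i" "i \<le> j" "j \<le> b" "j - i \<le> m"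
      have "L * real (j - i) \<le> L * m" using ij L by (intro mult_left_mono) auto
      then have "d (\<gamma> i) (\<gamma> j) \<le> d (\<gamma> i) (\<pi> i) + d (\<gamma> j) (\<pi> j) + L"
        using lip[of i j] f[of i] nonneg[of "\<gamma> j" "\<pi> j"] ij ab L by auto
      then have "d (\<pi> i) (\<pi> j) \<le> B" using path[of i] path[of j] ij ab by (intro contr) auto
      then show "d (g i) (g j) \<le> B" using ij by (simp add: g_def)
    qed (use assms ab in auto)
    then show ?thesis using ab by (simp add: g_def)
  qed
  \<comment> \<open>The slack \<open>L\<close> in \<open>contr\<close> covers a single step even
    when the path is close to \<open>Y\<close>.\<close>
  have step: "d (\<pi> i) (\<pi> (Suc i)) \<le> B" if "s \<le> i" "Suc i \<le> t" for i
    using lip[of i "Suc i"] path[of i] path[of "Suc i"] that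
      nonneg[of "\<gamma> i" "\<pi> i"] nonneg[of "\<gamma> (Suc i)" "\<pi> (Suc i)"]
    by (intro contr[of "\<gamma> i" "\<gamma> (Suc i)"]) auto
  define near where "near i \<longleftrightarrow> s \<le> i \<and> i \<le> t \<and> d (\<gamma> i) (\<pi> i) \<le> L * m" for i
  have frac: "B * (real a / m + c) \<le> B * (real b / m + c)" if "a \<le> b" for a b :: nat and c :: real
    using that assms(2) by (intro mult_left_mono add_right_mono divide_right_mono) auto
  show ?thesis
  proof (cases "\<exists>i. near i")
    case False
    then have "d (\<pi> s) (\<pi> t) \<le> B * (real (t - s) / m + 1)"
      using assms(4) unfolding near_def by (intro far) (simp_all, metis not_le)
    then have "d (\<pi> s) (\<pi> t) \<le> B * (real (t - s) / m + 4)"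
      using assms(2) by (simp add: algebra_simps)
    then show ?thesis using big Q by linarith
  next
    case True
    define i where "i = (LEAST i. near i)"
    define j where "j = (GREATEST i. near i)"
    have bd: "\<And>i. near i \<Longrightarrow> i \<le> t" by (simp add: near_def)
    have i: "near i" unfolding i_def using True by (metis LeastI)
    have j: "near j" unfolding j_def using True bd by (metis GreatestI_nat)
    have imin: "\<not> near l" if "l < i" for l using that not_less_Least unfolding i_def by blast
    have jmax: "l \<le> j" if "near l" for l unfolding j_def using that bd by (metis Greatest_le_nat)
    have ij: "s \<le> i" "i \<le> j" "j \<le> t" using i j jmax[OF i] by (auto simp: near_def)
    have 1: "d (\<pi> s) (\<pi> i) \<le> B * (real (i - s) / m + 2)"
    proof (cases "i = s")
      case True
      then show ?thesis using refl[OF piM[of s]] assms(2,4) by simp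
    next
      case False
      define l where "l = i - 1"
      have l: "i = Suc l" "s \<le> l" "l \<le> t" "Suc l \<le> t" using False ij by (auto simp: l_def)
      have "d (\<gamma> l') (\<pi> l') > L * m" if "s \<le> l'" "l' \<le> l" for l'
        using imin[of l'] that l by (auto simp: near_def not_le)
      then have "d (\<pi> s) (\<pi> l) \<le> B * (real (l - s) / m + 1)"
        using l by (intro far) auto
      also have "\<dots> \<le> B * (real (i - s) / m + 1)" using l by (intro frac) auto
      finally show ?thesis
        using step[of l] triangle[of "\<pi> s" "\<pi> l" "\<pi> i"] piM l ij assms(4)
        by (auto simp: algebra_simps)
    qed
    have 2: "d (\<pi> j) (\<pi> t) \<le> B * (real (t - j) / m + 2)"
    proof (cases "j = t")
      case True
      then show ?thesis using refl[OF piM[of t]] assms(2,4) by simp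
    next
      case False
      have l: "s \<le> Suc j" "Suc j \<le> t" "s \<le> j" using False ij by auto
      have "d (\<gamma> l') (\<pi> l') > L * m" if "Suc j \<le> l'" "l' \<le> t" for l'
        using jmax[of l'] that l by (force simp: near_def not_le)
      then have "d (\<pi> (Suc j)) (\<pi> t) \<le> B * (real (t - Suc j) / m + 1)"
        using l by (intro far) auto
      also have "\<dots> \<le> B * (real (t - j) / m + 1)" by (intro frac) auto
      finally show ?thesis
        using step[of j] triangle[of "\<pi> j" "\<pi> (Suc j)" "\<pi> t"] piM l ij assms(4)
        by (auto simp: algebra_simps)
    qed
    have "real (i - s) + real (t - j) \<le> real (t - s)" using ij by auto
    then have "B * ((real (i - s) + real (t - j)) / m + 4) \<le> B * (real (t - s) / m + 4)"
      using assms(2) by (intro mult_left_mono add_right_mono divide_right_mono) auto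
    moreover have "B * ((real (i - s) + real (t - j)) / m + 4)
      = B * (real (i - s) / m + 2) + B * (real (t - j) / m + 2)"
      by (simp add: algebra_simps add_divide_distrib)
    moreover have "d (\<pi> s) (\<pi> t) \<le> d (\<pi> s) (\<pi> i) + d (\<pi> i) (\<pi> j) + d (\<pi> j) (\<pi> t)"
      using triangle[of "\<pi> s" "\<pi> i" "\<pi> t"] triangle[of "\<pi> i" "\<pi> j" "\<pi> t"] piM ij assms(4) by force
    ultimately have "d (\<pi> i) (\<pi> j) \<ge> Q" using 1 2 big by linarith
    then show ?thesis using i j ij by (auto simp: near_def)
  qed
qed

text \<open>The radius \<open>r\<close> is fixed before \<open>Q\<close>: acylindricity supplies a separation \<open>Q\<close> depending
  on \<open>r\<close>.\<close>
lemma linear_progress_near_points: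
  fixes L c :: real
  assumes "linearly_connected Y s A" "Y \<subseteq> M" "s \<ge> 0" "A \<ge> 1" and "L \<ge> 0" "c0 > 0"
  shows "\<exists>r\<ge>0. \<forall>Q\<ge>0. \<exists>m n0. \<forall>n\<ge>n0. \<forall>\<gamma> \<pi>.
    (\<forall>i\<le>n. \<gamma> i \<in> M \<and> nearest Y (\<gamma> i) (\<pi> i)) \<longrightarrow>
    (\<forall>i j. i \<le> j \<longrightarrow> j \<le> n \<longrightarrow> d (\<gamma> i) (\<gamma> j) \<le> L * real (j - i)) \<longrightarrow>
    d (\<pi> 0) (\<pi> n) \<ge> c0 * real n - c \<longrightarrow>
    (\<exists>i j. i \<le> j \<and> j \<le> n \<and> j - i \<le> m \<and> d (\<gamma> i) (\<pi> i) \<le> r \<and> d (\<gamma> j) (\<pi> j) \<le> r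
      \<and> d (\<pi> i) (\<pi> j) \<ge> Q)"
proof -
  obtain B where B: "B \<ge> 0" and contr: "\<And>p q x y. \<lbrakk>p \<in> M; q \<in> M; nearest Y p x; nearest Y q y;
      d p q \<le> d p x + d q y + L\<rbrakk> \<Longrightarrow> d x y \<le> B"
    using contracting_projection[OF assms(1-4), of L] by blast
  \<comment> \<open>With \<open>B / m \<le> c0 / 4\<close>, far stretches advance at no more than a
    quarter of the rate \<open>c0\<close>. This choice, and hence the radius \<open>L * m\<close>,
    is independent of \<open>Q\<close>.\<close>
  define m where "m = nat \<lceil>4 * B / c0\<rceil> + 1"
  have "4 * B / c0 \<le> real m" unfolding m_def by linarith
  then have m: "m > 0" "B / m \<le> c0 / 4" using assms(6) by (auto simp: m_def field_simps)
  show ?thesis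
  proof (intro exI[of _ "L * m"] conjI allI impI)
    show "L * m \<ge> 0" using assms(5) by simp
    fix Q :: real assume Q: "Q \<ge> 0"
    \<comment> \<open>Over \<open>m'\<close> steps a quarter of the rate also pays for
      \<open>4 * B + Q\<close>. Together with the quarter for far stretches this stays below
      \<open>P\<close>, which is half the rate over \<open>m'\<close> steps.\<close>
    define m' where "m' = nat \<lceil>4 * (4 * B + Q) / c0\<rceil> + 1"
    have "4 * (4 * B + Q) / c0 < real m'" unfolding m'_def by linarith
    then have m': "m' > 0" "4 * B + Q < c0 / 4 * m'" using assms(6) by (auto simp: m'_def field_simps)
    define P where "P = c0 / 2 * m'"
    define n0 where "n0 = nat \<lceil>2 * (c + P) / c0\<rceil> + 1"
    show "\<exists>m' n0. \<forall>n\<ge>n0. \<forall>\<gamma> \<pi>.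
      (\<forall>i\<le>n. \<gamma> i \<in> M \<and> nearest Y (\<gamma> i) (\<pi> i)) \<longrightarrow>
      (\<forall>i j. i \<le> j \<longrightarrow> j \<le> n \<longrightarrow> d (\<gamma> i) (\<gamma> j) \<le> L * real (j - i)) \<longrightarrow>
      d (\<pi> 0) (\<pi> n) \<ge> c0 * real n - c \<longrightarrow>
      (\<exists>i j. i \<le> j \<and> j \<le> n \<and> j - i \<le> m' \<and> d (\<gamma> i) (\<pi> i) \<le> L * m \<and> d (\<gamma> j) (\<pi> j) \<le> L * m
        \<and> d (\<pi> i) (\<pi> j) \<ge> Q)"
    proof (rule exI[of _ m'], rule exI[of _ n0], intro allI impI)
      fix n \<gamma> \<pi>
      assume n: "n \<ge> n0"
        and path: "\<forall>i\<le>n. \<gamma> i \<in> M \<and> nearest Y (\<gamma> i) (\<pi> i)"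
        and lip: "\<forall>i j. i \<le> j \<longrightarrow> j \<le> n \<longrightarrow> d (\<gamma> i) (\<gamma> j) \<le> L * real (j - i)"
        and prog: "d (\<pi> 0) (\<pi> n) \<ge> c0 * real n - c"
      have "2 * (c + P) / c0 < real n0" unfolding n0_def by linarith
      then have "2 * (c + P) / c0 < real n" using n by linarith
      then have n1: "c + P < c0 * n / 2" using assms(6) by (simp add: field_simps)
      have piM: "\<pi> i \<in> M" if "i \<le> n" for i
        using path that assms(2) by (auto simp: nearest_def)
      \<comment> \<open>Averaging: if no block of \<open>m'\<close> steps advanced by more than
        \<open>P\<close>, the total would be at most \<open>c0 * n / 2 + P\<close>, which is less
        than \<open>c0 * n - c\<close> by the choice of \<open>n0\<close>.\<close>
      have "\<exists>a b. a \<le> b \<and> b \<le> n \<and> b - a \<le> m' \<and> d (\<pi> a) (\<pi> b) > P"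
      proof (rule ccontr)
        assume no: "\<not> (\<exists>a b. a \<le> b \<and> b \<le> n \<and> b - a \<le> m' \<and> d (\<pi> a) (\<pi> b) > P)"
        define g where "g i = \<pi> (min n i)" for i
        have "d (g 0) (g n) \<le> P * (real (n - 0) / m' + 1)"
        proof (rule bounded_steps_imp_linear[where f = g])
          show "d (g i) (g k) \<le> d (g i) (g j) + d (g j) (g k)" for i j k
            unfolding g_def by (intro triangle piM) auto
          show "d (g i) (g j) \<le> P" if "i \<le> j" "j \<le> n" "j - i \<le> m'" for i j
            using that no by (force simp: g_def)
          show "P \<ge> 0" using assms(6) by (simp add: P_def)
        qed (use m' in auto)
        also have "\<dots> = c0 * n / 2 + P" using m' by (simp add: P_def field_simps)
        finally show False using prog n1 by (simp add: g_def)
      qed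
      then obtain a b where ab: "a \<le> b" "b \<le> n" "b - a \<le> m'" "d (\<pi> a) (\<pi> b) > P" by blast
      have "B * (real (b - a) / m) = B / m * real (b - a)" by simp
      also have "\<dots> \<le> c0 / 4 * m'" using m ab assms(6) B by (intro mult_mono) auto
      finally have "B * (real (b - a) / m + 4) + Q < P" using m' unfolding P_def by argo
      then have big: "B * (real (b - a) / m + 4) + Q < d (\<pi> a) (\<pi> b)" using ab by linarith
      have "\<exists>i j. a \<le> i \<and> i \<le> j \<and> j \<le> b \<and> d (\<gamma> i) (\<pi> i) \<le> L * m \<and> d (\<gamma> j) (\<pi> j) \<le> L * m
        \<and> d (\<pi> i) (\<pi> j) \<ge> Q"
        using path lip ab by (intro near_points_in_piece[OF assms(2) B m(1) ab(1) contr _ _ assms(5) big Q]) auto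
      then obtain i j where "a \<le> i" "i \<le> j" "j \<le> b" "d (\<gamma> i) (\<pi> i) \<le> L * m"
        "d (\<gamma> j) (\<pi> j) \<le> L * m" "d (\<pi> i) (\<pi> j) \<ge> Q" by blast
      moreover from this have "j - i \<le> m'" "j \<le> n" using ab by auto
      ultimately show "\<exists>i j. i \<le> j \<and> j \<le> n \<and> j - i \<le> m' \<and> d (\<gamma> i) (\<pi> i) \<le> L * m
        \<and> d (\<gamma> j) (\<pi> j) \<le> L * m \<and> d (\<pi> i) (\<pi> j) \<ge> Q" by blast
    qed
  qed
qed

end

section \<open>Word metrics and acylindricity\<close>

context group
begin

lemma inv_mult_cancel_left: "\<lbrakk>x \<in> carrier G; y \<in> carrier G\<rbrakk> \<Longrightarrow> inv x \<otimes> (x \<otimes> y) = y"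
  by (simp flip: m_assoc)

lemma mult_inv_cancel_left: "\<lbrakk>x \<in> carrier G; y \<in> carrier G\<rbrakk> \<Longrightarrow> x \<otimes> (inv x \<otimes> y) = y"
  by (simp flip: m_assoc)

section \<open>Evaluation of words\<close>

lemma word_eval_Nil [simp]: "word_eval G [] = \<one>"
  by (simp add: word_eval_def)

lemma word_eval_Cons [simp]: "word_eval G (x # w) = x \<otimes> word_eval G w"
  by (simp add: word_eval_def)

lemma word_eval_closed [simp]: "set w \<subseteq> carrier G \<Longrightarrow> word_eval G w \<in> carrier G"
  by (induction w) auto

lemma word_eval_append:
  "set v \<subseteq> carrier G \<Longrightarrow> set w \<subseteq> carrier G \<Longrightarrow>
    word_eval G (v @ w) = word_eval G v \<otimes> word_eval G w"
  by (induction v) (auto simp: m_assoc)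

lemma word_eval_rev_inv:
  "set w \<subseteq> carrier G \<Longrightarrow> word_eval G (rev (map (m_inv G) w)) = inv (word_eval G w)"
proof (induction w)
  case (Cons x w)
  then have "set (rev (map (m_inv G) w)) \<subseteq> carrier G" by auto
  then show ?case using Cons by (simp add: word_eval_append inv_mult_group)
qed simp

text \<open>Moving a prefix to the end conjugates by that prefix. This links cyclic permutations of
  a word to the vertices of the path it labels.\<close>

lemma word_eval_rotate:
  assumes w: "set w \<subseteq> carrier G" and k: "k \<le> length w"
  shows "word_eval G (rotate k w)
    = inv (word_eval G (take k w)) \<otimes> word_eval G w \<otimes> word_eval G (take k w)"
proof -
  have sub: "set (take k w) \<subseteq> carrier G" "set (drop k w) \<subseteq> carrier G"
    using w by (auto dest: in_set_takeD in_set_dropD)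
  have w_eq: "word_eval G w = word_eval G (take k w) \<otimes> word_eval G (drop k w)"
    using word_eval_append[OF sub] by simp
  have "rotate k w = drop k w @ take k w"
    using k by (cases "k = length w") (auto simp: rotate_drop_take)
  then have "word_eval G (rotate k w) = word_eval G (drop k w) \<otimes> word_eval G (take k w)"
    using word_eval_append[OF sub(2,1)] by simp
  then show ?thesis
    unfolding w_eq using sub by (simp add: m_assoc inv_mult_cancel_left mult_inv_cancel_left)
qed

section \<open>Word length and word metric\<close>

lemma word_len_attained:
  assumes "gen_set_of G K S" "g \<in> K"
  obtains w where "w \<in> lists S" "word_eval G w = g" "length w = word_len G S g"
proof -
  have "\<exists>n. \<exists>w\<in>lists S. length w = n \<and> word_eval G w = g"
    using assms unfolding gen_set_of_def by blast
  from LeastI_ex[OF this] show ?thesis using that unfolding word_len_def by blast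
qed

lemma word_len_le: "w \<in> lists S \<Longrightarrow> word_len G S (word_eval G w) \<le> length w"
  unfolding word_len_def by (rule Least_le) auto

lemma word_len_one [simp]: "word_len G S \<one> = 0"
  using word_len_le[of "[]" S] by simp

lemma word_len_mult:
  assumes "gen_set G S" "g \<in> carrier G" "h \<in> carrier G"
  shows "word_len G S (g \<otimes> h) \<le> word_len G S g + word_len G S h"
proof -
  obtain v where v: "v \<in> lists S" "word_eval G v = g" "length v = word_len G S g"
    using word_len_attained assms(1,2) by blast
  obtain w where w: "w \<in> lists S" "word_eval G w = h" "length w = word_len G S h"
    using word_len_attained assms(1,3) by blast
  have "set v \<subseteq> carrier G" "set w \<subseteq> carrier G" using v w assms(1) by (auto simp: gen_set_of_def)
  then show ?thesis using word_len_le[of "v @ w" S] v w by (simp add: word_eval_append)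
qed

lemma word_len_inv_le:
  assumes "gen_set G S" "g \<in> carrier G"
  shows "word_len G S (inv g) \<le> word_len G S g"
proof -
  obtain v where v: "v \<in> lists S" "word_eval G v = g" "length v = word_len G S g"
    using word_len_attained assms by blast
  have "set v \<subseteq> carrier G" "rev (map (m_inv G) v) \<in> lists S"
    using v assms(1) by (auto simp: gen_set_of_def)
  then show ?thesis using word_len_le[of "rev (map (m_inv G) v)" S] v by (simp add: word_eval_rev_inv)
qed

lemma word_len_inv:
  assumes "gen_set G S" "g \<in> carrier G"
  shows "word_len G S (inv g) = word_len G S g"
  using word_len_inv_le[OF assms] word_len_inv_le[of S "inv g"] assms by simp

lemma word_len_word_eval_le:
  assumes "gen_set G T" "set w \<subseteq> carrier G" "\<And>s. s \<in> set w \<Longrightarrow> word_len G T s \<le> C"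
  shows "word_len G T (word_eval G w) \<le> C * length w"
  using assms(2,3)
proof (induction w)
  case (Cons s w)
  have "word_len G T (s \<otimes> word_eval G w) \<le> word_len G T s + word_len G T (word_eval G w)"
    using Cons.prems assms(1) by (intro word_len_mult) auto
  also have "\<dots> \<le> C + C * length w" using Cons by (intro add_mono) auto
  finally show ?case by simp
qed simp

lemma word_dist_self [simp]: "x \<in> carrier G \<Longrightarrow> word_dist G S x x = 0"
  by (simp add: word_dist_def)

lemma word_dist_triangle:
  assumes "gen_set G S" "x \<in> carrier G" "y \<in> carrier G" "z \<in> carrier G"
  shows "word_dist G S x z \<le> word_dist G S x y + word_dist G S y z"
proof -
  have "inv x \<otimes> z = (inv x \<otimes> y) \<otimes> (inv y \<otimes> z)"
    using assms by (simp add: m_assoc inv_mult_cancel_left mult_inv_cancel_left)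
  then show ?thesis
    using word_len_mult[OF assms(1), of "inv x \<otimes> y" "inv y \<otimes> z"] assms by (simp add: word_dist_def)
qed

lemma word_dist_sym:
  assumes "gen_set G S" "x \<in> carrier G" "y \<in> carrier G"
  shows "word_dist G S x y = word_dist G S y x"
  using word_len_inv[OF assms(1), of "inv x \<otimes> y"] assms by (simp add: word_dist_def inv_mult_group)

lemma word_dist_mult_left:
  assumes "g \<in> carrier G" "x \<in> carrier G" "y \<in> carrier G"
  shows "word_dist G S (g \<otimes> x) (g \<otimes> y) = word_dist G S x y"
proof -
  have "inv (g \<otimes> x) \<otimes> (g \<otimes> y) = inv x \<otimes> y"
    using assms by (simp add: inv_mult_group m_assoc inv_mult_cancel_left mult_inv_cancel_left)
  then show ?thesis by (simp add: word_dist_def)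
qed

lemma hyperbolic_metric_word_dist:
  assumes "gen_set G Z" "cayley_hyperbolic G Z"
  obtains \<delta> where "hyperbolic_metric (carrier G) (word_dist G Z) \<delta>"
proof -
  obtain \<delta> where \<delta>: "\<delta> \<ge> 0"
    "\<And>x y z w. \<lbrakk>x \<in> carrier G; y \<in> carrier G; z \<in> carrier G; w \<in> carrier G\<rbrakk> \<Longrightarrow>
        gromov_prod G Z x y w \<ge> min (gromov_prod G Z x z w) (gromov_prod G Z y z w) - \<delta>"
    using assms(2) unfolding cayley_hyperbolic_def by blast
  have "hyperbolic_metric (carrier G) (word_dist G Z) \<delta>"
  proof
    show "word_dist G Z x y \<ge> 0" for x y by (simp add: word_dist_def)
    show "word_dist G Z x y + word_dist G Z z w
      \<le> max (word_dist G Z x z + word_dist G Z y w) (word_dist G Z y z + word_dist G Z x w) + 2 * \<delta>"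
      if "x \<in> carrier G" "y \<in> carrier G" "z \<in> carrier G" "w \<in> carrier G" for x y z w
      using \<delta>(2)[OF that] by (auto simp: gromov_prod_def min_def max_def field_simps split: if_splits)
  qed (use assms \<delta> in \<open>auto intro: word_dist_triangle word_dist_sym\<close>)
  then show ?thesis by (rule that)
qed

section \<open>Finiteness from balls and from acylindricity\<close>

lemma finite_word_ball:
  assumes "finite S" "gen_set_of G K S"
  shows "finite {g \<in> K. word_len G S g \<le> n}"
proof (rule finite_subset)
  show "{g \<in> K. word_len G S g \<le> n} \<subseteq> word_eval G ` {w. set w \<subseteq> S \<and> length w \<le> n}"
  proof
    fix g assume g: "g \<in> {g \<in> K. word_len G S g \<le> n}"
    then obtain w where "w \<in> lists S" "word_eval G w = g" "length w = word_len G S g"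
      using word_len_attained assms(2) by blast
    then show "g \<in> word_eval G ` {w. set w \<subseteq> S \<and> length w \<le> n}" using g by force
  qed
  show "finite (word_eval G ` {w. set w \<subseteq> S \<and> length w \<le> n})"
    using finite_lists_length_le[OF assms(1)] by simp
qed

text \<open>If \<open>w, w'\<close> both belong to the set, \<open>inv w \<otimes> w'\<close> moves \<open>\<one>\<close> and \<open>h\<close> by at most \<open>2 * r\<close>.\<close>
lemma acylindrical_finite_displacements:
  assumes Z: "gen_set G Z" and "acylindrical_action G Z" "r \<ge> 0"
  obtains R where "R \<ge> 0" "\<And>g h. \<lbrakk>g \<in> carrier G; h \<in> carrier G; real (word_len G Z h) \<ge> R\<rbrakk> \<Longrightarrow>
    finite {w \<in> carrier G. real (word_len G Z w) \<le> r \<and> real (word_len G Z (inv g \<otimes> w \<otimes> h)) \<le> r}"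
proof -
  \<comment> \<open>Acylindricity is stated for positive constants and \<open>r\<close> may be 0,
    hence \<open>2 * r + 1\<close>.\<close>
  obtain R where R: "R \<ge> 0" "\<And>x y. \<lbrakk>x \<in> carrier G; y \<in> carrier G; word_dist G Z x y \<ge> R\<rbrakk> \<Longrightarrow>
      finite {t\<in>carrier G. word_dist G Z x (t \<otimes> x) \<le> 2 * r + 1 \<and> word_dist G Z y (t \<otimes> y) \<le> 2 * r + 1}"
    using assms(2)[unfolded acylindrical_action_def Let_def, rule_format, of "2 * r + 1"] assms(3)
    by auto
  have "finite {w \<in> carrier G. real (word_len G Z w) \<le> r \<and> real (word_len G Z (inv g \<otimes> w \<otimes> h)) \<le> r}"
    (is "finite ?W") if gh: "g \<in> carrier G" "h \<in> carrier G" "real (word_len G Z h) \<ge> R" for g h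
  proof (cases "?W = {}")
    case False
    then obtain w where w: "w \<in> carrier G" "real (word_len G Z w) \<le> r"
      "real (word_len G Z (inv g \<otimes> w \<otimes> h)) \<le> r" by auto
    let ?T = "{t\<in>carrier G. word_dist G Z \<one> (t \<otimes> \<one>) \<le> 2 * r + 1 \<and> word_dist G Z h (t \<otimes> h) \<le> 2 * r + 1}"
    have "?W \<subseteq> (\<lambda>t. w \<otimes> t) ` ?T"
    proof
      fix v assume "v \<in> ?W"
      then have v: "v \<in> carrier G" "real (word_len G Z v) \<le> r"
        "real (word_len G Z (inv g \<otimes> v \<otimes> h)) \<le> r" by auto
      have 1: "word_len G Z (inv w \<otimes> v) \<le> word_len G Z w + word_len G Z v"
        using word_len_mult[OF Z, of "inv w" v] word_len_inv[OF Z w(1)] w v by simp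
      have "inv h \<otimes> (inv w \<otimes> v \<otimes> h) = inv (inv g \<otimes> w \<otimes> h) \<otimes> (inv g \<otimes> v \<otimes> h)"
        using gh w v by (simp add: inv_mult_group m_assoc inv_mult_cancel_left mult_inv_cancel_left)
      then have 2: "word_len G Z (inv h \<otimes> (inv w \<otimes> v \<otimes> h))
          \<le> word_len G Z (inv g \<otimes> w \<otimes> h) + word_len G Z (inv g \<otimes> v \<otimes> h)"
        using word_len_mult[OF Z, of "inv (inv g \<otimes> w \<otimes> h)" "inv g \<otimes> v \<otimes> h"]
          word_len_inv[OF Z, of "inv g \<otimes> w \<otimes> h"] w v gh by simp
      have "inv w \<otimes> v \<in> ?T" using 1 2 w v by (simp add: word_dist_def)
      moreover have "v = w \<otimes> (inv w \<otimes> v)" using w v by (simp add: mult_inv_cancel_left)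
      ultimately show "v \<in> (\<lambda>t. w \<otimes> t) ` ?T" by blast
    qed
    moreover have "finite ?T" using gh by (intro R(2)) (auto simp: word_dist_def)
    ultimately show ?thesis by (meson finite_imageI finite_subset)
  next
    case True
    then show ?thesis by (metis finite.emptyI)
  qed
  then show ?thesis using that R(1) by blast
qed

section \<open>Labelled paths and projection to the subgroup\<close>

lemma word_eval_take_quotient:
  assumes "set w \<subseteq> carrier G" "g \<in> carrier G" "i \<le> j"
  shows "inv (g \<otimes> word_eval G (take i w)) \<otimes> (g \<otimes> word_eval G (take j w))
    = word_eval G (take (j - i) (drop i w))"
proof -
  have sub: "set (take i w) \<subseteq> carrier G" "set (take (j - i) (drop i w)) \<subseteq> carrier G"
    using assms(1) by (auto dest!: in_set_takeD in_set_dropD)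
  have "take j w = take i w @ take (j - i) (drop i w)"
    using take_add[of i "j - i" w] assms(3) by simp
  then have "word_eval G (take j w) = word_eval G (take i w) \<otimes> word_eval G (take (j - i) (drop i w))"
    using word_eval_append[OF sub] by simp
  then show ?thesis using sub assms(2)
    by (simp add: inv_mult_group m_assoc inv_mult_cancel_left)
qed

text \<open>The chain runs through \<open>x\<close> times the prefixes of a shortest word over
  \<open>S\<close> for \<open>inv x \<otimes> y\<close>. It stays in \<open>H\<close>, each step is
  a letter of \<open>S\<close>, and \<open>qi\<close> bounds the number of letters.\<close>

lemma qi_embedded_linearly_connected:
  assumes S: "gen_set_of G H S" "H \<subseteq> carrier G"
    and hyp: "hyperbolic_metric (carrier G) (word_dist G Z) \<delta>"
    and sub: "subgroup H G"
    and s: "\<And>x. x \<in> S \<Longrightarrow> word_len G Z x \<le> s"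
    and qi: "\<And>h. h \<in> H \<Longrightarrow> real (word_len G S h) \<le> L * (real (word_len G Z h) + c)"
    and L: "L \<ge> 0" "c \<ge> 0"
  shows "hyperbolic_metric.linearly_connected (word_dist G Z) H s (L * (c + 1))"
  unfolding hyperbolic_metric.linearly_connected_def[OF hyp]
proof (intro ballI)
  fix x y assume xy: "x \<in> H" "y \<in> H"
  have SH: "S \<subseteq> H" using S(1) by (simp add: gen_set_of_def)
  have evalH: "word_eval G v \<in> H" if "set v \<subseteq> H" for v
    using that by (induction v) (auto intro: subgroup.one_closed[OF sub] subgroup.m_closed[OF sub])
  have "inv x \<otimes> y \<in> H" using xy sub by (simp add: subgroup.m_closed subgroup.m_inv_closed)
  then obtain w where w: "w \<in> lists S" "word_eval G w = inv x \<otimes> y" "length w = word_len G S (inv x \<otimes> y)"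
    and le: "real (length w) \<le> L * (word_dist G Z x y + c)"
    using word_len_attained[OF S(1)] qi by (metis word_dist_def)
  have wH: "set w \<subseteq> H" "set w \<subseteq> carrier G" using w(1) SH S(2) by auto
  have step: "word_dist G Z (x \<otimes> word_eval G (take l w)) (x \<otimes> word_eval G (take (Suc l) w)) \<le> real s"
    if "l < length w" for l
  proof -
    have "take (Suc l - l) (drop l w) = [w ! l]" using that by (simp add: take_Suc hd_drop_conv_nth)
    moreover have "w ! l \<in> S" "w ! l \<in> carrier G" using that w(1) wH(2) nth_mem[OF that] by auto
    ultimately show ?thesis
      using word_eval_take_quotient[OF wH(2), of x l "Suc l"] xy S(2) s by (auto simp: word_dist_def)
  qed
  have "L * (word_dist G Z x y + c) \<le> L * ((c + 1) * (word_dist G Z x y + 1))"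
    using L by (intro mult_left_mono) (auto simp: word_dist_def algebra_simps)
  then have len: "real (length w) \<le> L * (c + 1) * (word_dist G Z x y + 1)" using le by (simp add: mult.assoc)
  have inH: "x \<otimes> word_eval G (take l w) \<in> H" for l
    using evalH[of "take l w"] wH(1) xy(1) by (auto intro!: subgroup.m_closed[OF sub] dest: in_set_takeD)
  show "\<exists>f N. f 0 = x \<and> f N = y \<and> f ` {..N} \<subseteq> H \<and>
      (\<forall>l<N. word_dist G Z (f l) (f (Suc l)) \<le> real s) \<and> real N \<le> L * (c + 1) * (word_dist G Z x y + 1)"
    using step len w(2) xy S(2) inH
    by (intro exI[of _ "\<lambda>l. x \<otimes> word_eval G (take l w)"] exI[of _ "length w"])
      (auto simp: mult_inv_cancel_left subset_iff)
qed

text \<open>Word distances are natural numbers, so the minimum is attained.\<close>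

lemma ex_nearest:
  assumes "hyperbolic_metric (carrier G) (word_dist G Z) \<delta>" "Y \<noteq> {}"
  shows "\<exists>x. hyperbolic_metric.nearest (word_dist G Z) Y p x"
proof -
  obtain y where "y \<in> Y" using assms(2) by auto
  then have "\<exists>x. x \<in> Y \<and> (\<forall>y. y \<in> Y \<longrightarrow> word_len G Z (inv p \<otimes> x) \<le> word_len G Z (inv p \<otimes> y))"
    by (rule ex_has_least_nat)
  then show ?thesis by (auto simp: hyperbolic_metric.nearest_def[OF assms(1)] word_dist_def)
qed

text \<open>Left multiplication by \<open>h\<close> is an isometry that preserves
  \<open>H\<close>.\<close>

lemma nearest_translate:
  assumes hyp: "hyperbolic_metric (carrier G) (word_dist G Z) \<delta>" and sub: "subgroup H G"
    and "h \<in> H" "p \<in> carrier G" "hyperbolic_metric.nearest (word_dist G Z) H p x"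
  shows "hyperbolic_metric.nearest (word_dist G Z) H (h \<otimes> p) (h \<otimes> x)"
  unfolding hyperbolic_metric.nearest_def[OF hyp]
proof (intro conjI ballI)
  have x: "x \<in> H" "\<And>y. y \<in> H \<Longrightarrow> word_dist G Z p x \<le> word_dist G Z p y"
    using assms(5) by (auto simp: hyperbolic_metric.nearest_def[OF hyp])
  have HG: "y \<in> carrier G" if "y \<in> H" for y using that subgroup.mem_carrier[OF sub] by blast
  show "h \<otimes> x \<in> H" using assms(3) x(1) by (rule subgroup.m_closed[OF sub])
  fix y assume y: "y \<in> H"
  then have z: "inv h \<otimes> y \<in> H"
    using assms(3) by (simp add: subgroup.m_closed[OF sub] subgroup.m_inv_closed[OF sub])
  have "word_dist G Z (h \<otimes> p) (h \<otimes> x) = word_dist G Z p x"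
    using assms(3,4) x(1) HG by (intro word_dist_mult_left) auto
  also have "\<dots> \<le> word_dist G Z p (inv h \<otimes> y)" by (rule x(2)[OF z])
  also have "\<dots> = word_dist G Z (h \<otimes> p) (h \<otimes> (inv h \<otimes> y))"
    using assms(3,4) z HG by (intro word_dist_mult_left[symmetric]) auto
  also have "h \<otimes> (inv h \<otimes> y) = y" using assms(3) y HG by (simp add: mult_inv_cancel_left)
  finally show "word_dist G Z (h \<otimes> p) (h \<otimes> x) \<le> word_dist G Z (h \<otimes> p) y" .
qed

end

section \<open>Bounded conjugators for shortest words\<close>

lemma finite_imp_nat_bounded:
  fixes f :: "'a \<Rightarrow> nat"
  assumes "finite A"
  obtains C where "\<And>a. a \<in> A \<Longrightarrow> f a \<le> C"
  using assms finite_nat_set_iff_bounded_le[of "f ` A"] by auto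

theorem theorem6p1:
  fixes G :: "('a, 'b) monoid_scheme" and Xs Z H :: "'a set"
  assumes "group G"
    and "finite Xs" and "gen_set G Xs"
    and "gen_set G Z"
    and "fin_gen_subgroup G H"
    and "qi_embedded G H Z"
    and "acylindrical_action G Z"
    and "cayley_hyperbolic G Z"
  shows "BCD_rel G Xs H"
proof -
  interpret group G by (rule assms(1))
  note X = assms(3) and Z = assms(4)
  have sub: "subgroup H G" using assms(5) by (simp add: fin_gen_subgroup_def)
  interpret H: subgroup H G by (rule sub)
  have HG [simp]: "y \<in> carrier G" if "y \<in> H" for y using that H.mem_carrier by blast
  have XsG: "Xs \<subseteq> carrier G" using X by (simp add: gen_set_of_def)
  obtain S L c where S: "finite S" "gen_set_of G H S" and L: "L \<ge> 1" "c \<ge> 0"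
    and qi: "\<And>h1 h2. \<lbrakk>h1 \<in> H; h2 \<in> H\<rbrakk> \<Longrightarrow> word_dist G S h1 h2 / L - c \<le> word_dist G Z h1 h2"
    using assms(6) unfolding qi_embedded_def by blast
  have SH: "S \<subseteq> H" using S by (simp add: gen_set_of_def)
  have qi_len: "real (word_len G S h) \<le> L * (real (word_len G Z h) + c)" if "h \<in> H" for h
    using qi[OF H.one_closed that] L that by (simp add: word_dist_def field_simps)
  obtain \<delta> where hyp: "hyperbolic_metric (carrier G) (word_dist G Z) \<delta>"
    using hyperbolic_metric_word_dist[OF Z assms(8)] .
  interpret hm: hyperbolic_metric "carrier G" "word_dist G Z" \<delta> by (rule hyp)
  obtain s where s: "\<And>x. x \<in> S \<Longrightarrow> word_len G Z x \<le> s" using finite_imp_nat_bounded[OF S(1)] by blast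
  obtain C where C: "\<And>x. x \<in> S \<Longrightarrow> word_len G Xs x \<le> C" using finite_imp_nat_bounded[OF S(1)] by blast
  obtain \<Lambda> where \<Lambda>: "\<And>x. x \<in> Xs \<Longrightarrow> word_len G Z x \<le> \<Lambda>" using finite_imp_nat_bounded[OF assms(2)] by blast
  have conn: "hm.linearly_connected H s (L * (c + 1))"
    using S(2) sub s qi_len L HG by (intro qi_embedded_linearly_connected[OF _ _ hyp]) auto
  have A1: "L * (c + 1) \<ge> 1" using mult_mono[of 1 L 1 "c + 1"] L by simp
  \<comment> \<open>The rate of progress: one factor for passing from length over \<open>Xs\<close>
    to length over \<open>S\<close>, one for the quasi-isometry. Adding 1 keeps the denominator
    positive when \<open>C = 0\<close>.\<close>
  define c0 where "c0 = 1 / (L * (real C + 1))"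
  have c0: "c0 > 0" using L by (simp add: c0_def)
  obtain r where r: "r \<ge> 0" and r_prog: "\<And>Q. Q \<ge> 0 \<Longrightarrow> \<exists>m n0. \<forall>n\<ge>n0. \<forall>\<gamma> \<pi>.
    (\<forall>i\<le>n. \<gamma> i \<in> carrier G \<and> hm.nearest H (\<gamma> i) (\<pi> i)) \<longrightarrow>
    (\<forall>i j. i \<le> j \<longrightarrow> j \<le> n \<longrightarrow> word_dist G Z (\<gamma> i) (\<gamma> j) \<le> real \<Lambda> * real (j - i)) \<longrightarrow>
    word_dist G Z (\<pi> 0) (\<pi> n) \<ge> c0 * real n - c \<longrightarrow>
    (\<exists>i j. i \<le> j \<and> j \<le> n \<and> j - i \<le> m \<and> word_dist G Z (\<gamma> i) (\<pi> i) \<le> r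
      \<and> word_dist G Z (\<gamma> j) (\<pi> j) \<le> r \<and> word_dist G Z (\<pi> i) (\<pi> j) \<ge> Q)"
    using hm.linear_progress_near_points[OF conn H.subset of_nat_0_le_iff A1 of_nat_0_le_iff c0] by metis
  obtain R where R: "R \<ge> 0"
    "\<And>g h. \<lbrakk>g \<in> carrier G; h \<in> carrier G; real (word_len G Z h) \<ge> R\<rbrakk> \<Longrightarrow>
    finite {w \<in> carrier G. real (word_len G Z w) \<le> r \<and> real (word_len G Z (inv\<^bsub>G\<^esub> g \<otimes>\<^bsub>G\<^esub> w \<otimes>\<^bsub>G\<^esub> h)) \<le> r}"
    using acylindrical_finite_displacements[OF Z assms(7) r] by blast
  obtain m n0 where prog: "\<And>n \<gamma> \<pi>. \<lbrakk>n \<ge> n0;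
    \<And>i. i \<le> n \<Longrightarrow> \<gamma> i \<in> carrier G \<and> hm.nearest H (\<gamma> i) (\<pi> i);
    \<And>i j. i \<le> j \<Longrightarrow> j \<le> n \<Longrightarrow> word_dist G Z (\<gamma> i) (\<gamma> j) \<le> real \<Lambda> * real (j - i);
    word_dist G Z (\<pi> 0) (\<pi> n) \<ge> c0 * real n - c\<rbrakk> \<Longrightarrow>
    \<exists>i j. i \<le> j \<and> j \<le> n \<and> j - i \<le> m \<and> word_dist G Z (\<gamma> i) (\<pi> i) \<le> r
      \<and> word_dist G Z (\<gamma> j) (\<pi> j) \<le> r \<and> word_dist G Z (\<pi> i) (\<pi> j) \<ge> R"
    using r_prog[OF R(1)] by metis
  \<comment> \<open>Two path points at most \<open>m\<close> letters apart and within
    \<open>r\<close> of their projections have projections at \<open>Z\<close>-distance at most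
    \<open>2 * r + \<Lambda> * m\<close>; \<open>q\<close> bounds the corresponding length over
    \<open>S\<close>.\<close>
  define q where "q = nat \<lceil>L * (2 * r + real \<Lambda> * m + c)\<rceil>"
  \<comment> \<open>Candidates for the element leading from a near path point to its projection:
    \<open>g\<close> is the path segment between two near points, \<open>h\<close> the element of
    \<open>H\<close> between their projections. Both range over finite balls.\<close>
  define W where "W = (\<Union>g\<in>{g \<in> carrier G. word_len G Xs g \<le> m}.
    \<Union>h\<in>{h \<in> {h \<in> H. word_len G S h \<le> q}. real (word_len G Z h) \<ge> R}.
    {w \<in> carrier G. real (word_len G Z w) \<le> r \<and> real (word_len G Z (inv\<^bsub>G\<^esub> g \<otimes>\<^bsub>G\<^esub> w \<otimes>\<^bsub>G\<^esub> h)) \<le> r})"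
  have "finite {h \<in> {h \<in> H. word_len G S h \<le> q}. real (word_len G Z h) \<ge> R}"
    using finite_word_ball[OF S, of q] by (rule finite_subset[rotated]) auto
  then have "finite W"
    unfolding W_def by (intro finite_UN_I R(2) finite_word_ball[OF assms(2) X]) auto
  then obtain K1 where K1: "\<And>w. w \<in> W \<Longrightarrow> word_len G Xs w \<le> K1" using finite_imp_nat_bounded by blast
  \<comment> \<open>Words of length at most \<open>n0\<close> are settled by choosing one conjugator
    for each; the choice matters only when a conjugator into \<open>H\<close> exists.\<close>
  define conj where
    "conj U = (SOME g. g \<in> carrier G \<and> g \<otimes>\<^bsub>G\<^esub> word_eval G U \<otimes>\<^bsub>G\<^esub> inv\<^bsub>G\<^esub> g \<in> H)" for U
  have "finite {U. set U \<subseteq> Xs \<and> length U \<le> n0}" by (rule finite_lists_length_le[OF assms(2)])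
  then obtain K0 where K0: "\<And>U. U \<in> {U. set U \<subseteq> Xs \<and> length U \<le> n0} \<Longrightarrow> word_len G Xs (conj U) \<le> K0"
    using finite_imp_nat_bounded[where f = "\<lambda>U. word_len G Xs (conj U)"] by blast
  have "\<exists>g\<in>carrier G. word_len G Xs g \<le> max K0 K1 \<and>
      (\<exists>k. g \<otimes>\<^bsub>G\<^esub> word_eval G (rotate k U) \<otimes>\<^bsub>G\<^esub> inv\<^bsub>G\<^esub> g \<in> H)"
    if U: "U \<in> lists Xs"
      and min: "\<forall>V\<in>lists Xs. (\<exists>g\<in>carrier G. word_eval G V = g \<otimes>\<^bsub>G\<^esub> word_eval G U \<otimes>\<^bsub>G\<^esub> inv\<^bsub>G\<^esub> g)
         \<longrightarrow> length U \<le> length V"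
      and inH: "\<exists>g\<in>carrier G. g \<otimes>\<^bsub>G\<^esub> word_eval G U \<otimes>\<^bsub>G\<^esub> inv\<^bsub>G\<^esub> g \<in> H" for U
  proof (cases "length U \<le> n0")
    case True
    have "conj U \<in> carrier G \<and> conj U \<otimes>\<^bsub>G\<^esub> word_eval G U \<otimes>\<^bsub>G\<^esub> inv\<^bsub>G\<^esub> (conj U) \<in> H"
      unfolding conj_def using someI_ex[of "\<lambda>g. g \<in> carrier G \<and> g \<otimes>\<^bsub>G\<^esub> word_eval G U \<otimes>\<^bsub>G\<^esub> inv\<^bsub>G\<^esub> g \<in> H"] inH
      by blast
    moreover have "word_len G Xs (conj U) \<le> K0" using U True by (intro K0) auto
    ultimately show ?thesis
      by (intro bexI[of _ "conj U"] conjI exI[of _ 0]) auto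
  next
    case False
    define n where "n = length U"
    define u where "u = word_eval G U"
    have UG: "set U \<subseteq> carrier G" using U XsG by auto
    then have u [simp]: "u \<in> carrier G" by (simp add: u_def)
    have takeG [simp]: "word_eval G (take i U) \<in> carrier G" for i
      using UG by (intro word_eval_closed) (auto dest: in_set_takeD)
    obtain g0 where g0 [simp]: "g0 \<in> carrier G" and hH: "g0 \<otimes>\<^bsub>G\<^esub> u \<otimes>\<^bsub>G\<^esub> inv\<^bsub>G\<^esub> g0 \<in> H"
      using inH by (auto simp: u_def)
    define h where "h = g0 \<otimes>\<^bsub>G\<^esub> u \<otimes>\<^bsub>G\<^esub> inv\<^bsub>G\<^esub> g0"
    have h [simp]: "h \<in> H" using hH by (simp add: h_def)
    define \<gamma> where "\<gamma> i = g0 \<otimes>\<^bsub>G\<^esub> word_eval G (take i U)" for i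
    have \<gamma>G [simp]: "\<gamma> i \<in> carrier G" for i by (simp add: \<gamma>_def)
    have \<gamma>n: "\<gamma> n = h \<otimes>\<^bsub>G\<^esub> \<gamma> 0"
      by (simp add: \<gamma>_def n_def h_def m_assoc flip: u_def)
    have "\<forall>i. \<exists>x. hm.nearest H (\<gamma> i) x"
      using ex_nearest[OF hyp, of H] h by blast
    then obtain \<pi>0 where \<pi>0: "\<And>i. hm.nearest H (\<gamma> i) (\<pi>0 i)" by metis
    \<comment> \<open>The end of the path is the \<open>h\<close>-translate of its start, so its
      projection may be chosen as the translate too. The value at 0 is unchanged because
      \<open>n > n0\<close>.\<close>
    define \<pi> where "\<pi> = \<pi>0(n := h \<otimes>\<^bsub>G\<^esub> \<pi>0 0)"
    have near: "hm.nearest H (\<gamma> i) (\<pi> i)" for i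
      using \<pi>0[of i] nearest_translate[OF hyp sub h \<gamma>G \<pi>0[of 0]] \<gamma>n by (simp add: \<pi>_def)
    then have \<pi>H [simp]: "\<pi> i \<in> H" for i by (simp add: hm.nearest_def)
    have \<pi>n: "\<pi> n = h \<otimes>\<^bsub>G\<^esub> \<pi> 0" using False by (auto simp: \<pi>_def n_def)
    have quot: "inv\<^bsub>G\<^esub> (\<gamma> i) \<otimes>\<^bsub>G\<^esub> \<gamma> j = word_eval G (take (j - i) (drop i U))" if "i \<le> j" for i j
      unfolding \<gamma>_def using that UG by (intro word_eval_take_quotient) auto
    have seg: "set (take (j - i) (drop i U)) \<subseteq> Xs" for i j
      using U by (auto dest!: in_set_takeD in_set_dropD)
    have lip: "word_dist G Z (\<gamma> i) (\<gamma> j) \<le> real \<Lambda> * real (j - i)" if "i \<le> j" for i j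
    proof -
      have "word_len G Z (word_eval G (take (j - i) (drop i U))) \<le> \<Lambda> * length (take (j - i) (drop i U))"
        using seg[of j i] XsG \<Lambda> by (intro word_len_word_eval_le[OF Z]) auto
      also have "\<dots> \<le> \<Lambda> * (j - i)" by simp
      finally show ?thesis using quot[OF that] by (simp add: word_dist_def flip: of_nat_mult)
    qed
    have progress: "c0 * real n - c \<le> word_dist G Z (\<pi> 0) (\<pi> n)"
    proof -
      define h' where "h' = inv\<^bsub>G\<^esub> (\<pi> 0) \<otimes>\<^bsub>G\<^esub> \<pi> n"
      have h'H: "h' \<in> H" by (simp add: h'_def)
      obtain V where V: "V \<in> lists Xs" "word_eval G V = h'" "length V = word_len G Xs h'"
        using word_len_attained[OF X] HG[OF h'H] by blast
      obtain v where v: "v \<in> lists S" "word_eval G v = h'" "length v = word_len G S h'"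
        using word_len_attained[OF S(2) h'H] by blast
      \<comment> \<open>As \<open>h'\<close> is conjugate to \<open>u\<close>, minimality of
        \<open>U\<close> bounds \<open>n\<close> by the length of \<open>h'\<close> over
        \<open>Xs\<close>.\<close>
      have "h' = (inv\<^bsub>G\<^esub> (\<pi> 0) \<otimes>\<^bsub>G\<^esub> g0) \<otimes>\<^bsub>G\<^esub> u \<otimes>\<^bsub>G\<^esub> inv\<^bsub>G\<^esub> (inv\<^bsub>G\<^esub> (\<pi> 0) \<otimes>\<^bsub>G\<^esub> g0)"
        by (simp add: h'_def \<pi>n h_def inv_mult_group m_assoc)
      then have "n \<le> length V"
        unfolding n_def using V min by (auto simp: u_def intro!: bexI[of _ "inv\<^bsub>G\<^esub> (\<pi> 0) \<otimes>\<^bsub>G\<^esub> g0"])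
      also have "\<dots> \<le> C * length v"
      proof -
        have "set v \<subseteq> S" "set v \<subseteq> carrier G" using v(1) SH H.subset by auto
        then show ?thesis using C v(2) V(3) word_len_word_eval_le[OF X, of v C] by auto
      qed
      finally have "real n \<le> real (C * length v)" by (rule of_nat_mono)
      also have "\<dots> \<le> (real C + 1) * length v" by (simp add: algebra_simps)
      finally have "c0 * real n \<le> c0 * ((real C + 1) * length v)" using c0 by (intro mult_left_mono) auto
      also have "\<dots> = real (length v) / L"
      proof -
        have "real C + 1 \<noteq> 0" by linarith
        then show ?thesis by (simp add: c0_def)
      qed
      also have "\<dots> = word_dist G S (\<pi> 0) (\<pi> n) / L" using v by (simp add: word_dist_def h'_def)
      finally show ?thesis using qi[of "\<pi> 0" "\<pi> n"] by simp
    qed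
    obtain i j where ij: "i \<le> j" "j \<le> n" "j - i \<le> m"
      and close: "word_dist G Z (\<gamma> i) (\<pi> i) \<le> r" "word_dist G Z (\<gamma> j) (\<pi> j) \<le> r"
      and apart: "word_dist G Z (\<pi> i) (\<pi> j) \<ge> R"
      using prog[of n \<gamma> \<pi>] False near lip progress by (auto simp: n_def)
    define w where "w = inv\<^bsub>G\<^esub> (\<gamma> i) \<otimes>\<^bsub>G\<^esub> \<pi> i"
    have w [simp]: "w \<in> carrier G" by (simp add: w_def)
    define g where "g = inv\<^bsub>G\<^esub> (\<gamma> i) \<otimes>\<^bsub>G\<^esub> \<gamma> j"
    define k where "k = inv\<^bsub>G\<^esub> (\<pi> i) \<otimes>\<^bsub>G\<^esub> \<pi> j"
    have k: "k \<in> H" by (simp add: k_def)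
    have "word_len G Xs g \<le> j - i"
      using word_len_le[of "take (j - i) (drop i U)" Xs] seg[of j i] quot[OF ij(1)]
      by (auto simp: g_def lists_eq_set)
    then have gW: "g \<in> carrier G" "word_len G Xs g \<le> m" using ij by (auto simp: g_def)
    have "word_dist G Z (\<pi> i) (\<pi> j) \<le> word_dist G Z (\<pi> i) (\<gamma> i) + word_dist G Z (\<gamma> i) (\<gamma> j) + word_dist G Z (\<gamma> j) (\<pi> j)"
      using hm.triangle[of "\<pi> i" "\<gamma> i" "\<pi> j"] hm.triangle[of "\<gamma> i" "\<gamma> j" "\<pi> j"] by simp
    also have "\<dots> \<le> r + real \<Lambda> * (j - i) + r"
      using close lip[OF ij(1)] hm.sym[of "\<pi> i" "\<gamma> i"] by simp
    also have "\<dots> \<le> 2 * r + real \<Lambda> * m"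
      using mult_left_mono[of "real (j - i)" "real m" "real \<Lambda>"] ij(3) by simp
    finally have "L * (real (word_len G Z k) + c) \<le> L * (2 * r + real \<Lambda> * m + c)"
      using L by (intro mult_left_mono) (auto simp: word_dist_def k_def)
    then have "real (word_len G S k) \<le> L * (2 * r + real \<Lambda> * m + c)"
      using qi_len[OF k] by linarith
    then have kq: "word_len G S k \<le> q" unfolding q_def by linarith
    have kR: "real (word_len G Z k) \<ge> R" using apart by (simp add: word_dist_def k_def)
    \<comment> \<open>Both ways around the quadrilateral of path points and projections agree, so
      both displacements required in \<open>W\<close> have \<open>Z\<close>-length at most
      \<open>r\<close>.\<close>
    have "inv\<^bsub>G\<^esub> g \<otimes>\<^bsub>G\<^esub> w \<otimes>\<^bsub>G\<^esub> k = inv\<^bsub>G\<^esub> (\<gamma> j) \<otimes>\<^bsub>G\<^esub> \<pi> j"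
      by (simp add: g_def w_def k_def inv_mult_group m_assoc mult_inv_cancel_left)
    then have "w \<in> W"
      unfolding W_def using gW k kq kR close by (force simp: word_dist_def w_def)
    then have len: "word_len G Xs (inv\<^bsub>G\<^esub> w) \<le> K1" using K1 word_len_inv[OF X w] by simp
    \<comment> \<open>The prefix in \<open>\<gamma> i\<close> cancels the one from the rotation,
      leaving a conjugate of \<open>h\<close> by an element of \<open>H\<close>.\<close>
    have "inv\<^bsub>G\<^esub> w \<otimes>\<^bsub>G\<^esub> word_eval G (rotate i U) \<otimes>\<^bsub>G\<^esub> inv\<^bsub>G\<^esub> (inv\<^bsub>G\<^esub> w)
        = inv\<^bsub>G\<^esub> (\<pi> i) \<otimes>\<^bsub>G\<^esub> h \<otimes>\<^bsub>G\<^esub> \<pi> i"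
      using ij UG
      by (simp add: word_eval_rotate n_def w_def h_def \<gamma>_def inv_mult_group m_assoc
          mult_inv_cancel_left inv_mult_cancel_left flip: u_def)
    then have "inv\<^bsub>G\<^esub> w \<otimes>\<^bsub>G\<^esub> word_eval G (rotate i U) \<otimes>\<^bsub>G\<^esub> inv\<^bsub>G\<^esub> (inv\<^bsub>G\<^esub> w) \<in> H" by simp
    then show ?thesis using len by (intro bexI[of _ "inv\<^bsub>G\<^esub> w"]) auto
  qed
  then show ?thesis unfolding BCD_rel_def by blast
qed

end
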